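(* Let $0<a<b$ be coprime integers and $A=\{0,a,b\}$. Then for every integer $N\ge 1$, $$NA = \{0 , 1,\ldots , bN \} \setminus \big(\mathcal E(A) \cup (bN - \mathcal E(b-A))\big).$$
   Context: $\mathbb N=\{0,1,2,\dots\}$. For an integer $N\ge1$, $NA=\{a_1+\cdots+a_N: a_i\in A\}$ (repetitions allowed). For a finite set $X\subset\mathbb N$, $\mathcal P(X)=\{\sum_{x\in X} n_x x: n_x\in\mathbb N\}$ and $\mathcal E(X)=\mathbb N\setminus\mathcal P(X)$. $b-A=\{b-x:x\in A\}$, and for an integer $m$ and a set $Y$, $m-Y=\{m-y:y\in Y\}$. *)

theory Defs
  imports Main
begin

(* Everything lives in int, because m - Y may contain negative numbers, for which
   truncated subtraction on nat would be wrong. The natural numbers are the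
   subset Nats of int. *)

definition fold_sumset :: "nat \<Rightarrow> int set \<Rightarrow> int set" where
  "fold_sumset N A = {\<Sum>i=1..N. a i | a. \<forall>i\<in>{1..N}. a i \<in> A}"

(* Intended for finite X only: a sum over an infinite set is 0. *)
definition nat_span :: "int set \<Rightarrow> int set" where
  "nat_span X = {\<Sum>x\<in>X. int (n x) * x | n :: int \<Rightarrow> nat. True}"

definition exceptional :: "int set \<Rightarrow> int set" where
  "exceptional X = \<nat> - nat_span X"

definition reflect :: "int \<Rightarrow> int set \<Rightarrow> int set" where
  "reflect m Y = {m - y | y. y \<in> Y}"

end

theory Submission
  imports Defs
begin

text \<open>
  If \<open>n = a x + b y\<close> and \<open>b N - n = (b - a) u + b v\<close> with nonnegative integers \<open>x\<close>, \<open>y\<close>, \<open>u\<close>, \<open>v\<close>,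
  then either \<open>x \<le> u\<close>, and \<open>x + y \<le> N\<close>, or \<open>u \<le> x\<close>, and \<open>n = a u + b (N - u - v)\<close> with
  \<open>N - u - v \<ge> y \<ge> 0\<close>. In both cases \<open>n\<close> is a sum of \<open>N\<close> elements of \<open>{0, a, b}\<close>.
\<close>

text \<open>Order is irrelevant, and the summand 0 pads any shorter sum to length \<open>N\<close>,
  so only the multiplicities of \<open>a\<close> and \<open>b\<close> matter.\<close>

lemma fold_sumset_triple:
  fixes a b :: int
  shows "fold_sumset N {0, a, b} = {a * int x + b * int y | x y. x + y \<le> N}"
proof (intro equalityI subsetI)
  fix n assume "n \<in> fold_sumset N {0, a, b}"
  then obtain f where f: "n = (\<Sum>i=1..N. f i)" "\<forall>i\<in>{1..N}. f i \<in> {0, a, b}"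
    unfolding fold_sumset_def by blast
  have "\<exists>x y. x + y \<le> M \<and> (\<Sum>i=1..M. f i) = a * int x + b * int y" if "M \<le> N" for M
    using that
  proof (induction M)
    case (Suc M)
    then obtain x y where xy: "x + y \<le> M" "(\<Sum>i=1..M. f i) = a * int x + b * int y"
      by auto
    have "f (Suc M) \<in> {0, a, b}"
      using f(2) Suc.prems by simp
    then consider "f (Suc M) = 0" | "f (Suc M) = a" | "f (Suc M) = b"
      by blast
    then show ?case
    proof cases
      case 1
      with xy show ?thesis by (intro exI[of _ x] exI[of _ y]) simp
    next
      case 2
      with xy show ?thesis by (intro exI[of _ "Suc x"] exI[of _ y]) (simp add: algebra_simps)
    next
      case 3
      with xy show ?thesis by (intro exI[of _ x] exI[of _ "Suc y"]) (simp add: algebra_simps)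
    qed
  qed simp
  with f(1) show "n \<in> {a * int x + b * int y | x y. x + y \<le> N}"
    by blast
next
  fix n assume "n \<in> {a * int x + b * int y | x y. x + y \<le> N}"
  then obtain x y where n: "n = a * int x + b * int y" and "x + y \<le> N"
    by blast
  \<comment> \<open>A block of \<open>x\<close> copies of \<open>a\<close>, then \<open>y\<close>
    copies of \<open>b\<close>, then zeros up to index \<open>N\<close>.\<close>
  define f where "f i = (if i \<le> x then a else if i \<le> x + y then b else 0)" for i
  have "(\<Sum>i=1..N. f i) = (\<Sum>i=1..x + y. f i)"
    using \<open>x + y \<le> N\<close> by (intro sum.mono_neutral_right) (auto simp: f_def)
  also have "\<dots> = (\<Sum>i=1..x. f i) + (\<Sum>i=x+1..x+y. f i)"
    by (rule sum.ub_add_nat) simp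
  also have "(\<Sum>i=1..x. f i) = (\<Sum>i=1..x. a)"
    by (intro sum.cong) (auto simp: f_def)
  also have "(\<Sum>i=x+1..x+y. f i) = (\<Sum>i=x+1..x+y. b)"
    by (intro sum.cong) (auto simp: f_def)
  finally have "n = (\<Sum>i=1..N. f i)"
    by (simp add: n mult.commute)
  moreover have "\<forall>i\<in>{1..N}. f i \<in> {0, a, b}"
    by (simp add: f_def)
  ultimately show "n \<in> fold_sumset N {0, a, b}"
    unfolding fold_sumset_def by blast
qed

text \<open>Trades the joint bound \<open>x + y \<le> N\<close> for two separate representability
  conditions, which become the two spans in the theorem.\<close>

lemma fold_sumset_triple_iff:
  fixes a b :: int
  assumes "0 < a" "a < b"
  shows "n \<in> fold_sumset N {0, a, b} \<longleftrightarrow>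
    (\<exists>x y. n = a * int x + b * int y) \<and> (\<exists>u v. b * int N - n = (b - a) * int u + b * int v)"
proof (intro iffI conjI)
  assume "n \<in> fold_sumset N {0, a, b}"
  then obtain x y where n: "n = a * int x + b * int y" and xy: "x + y \<le> N"
    unfolding fold_sumset_triple by blast
  \<comment> \<open>Subtracting every summand from \<open>b\<close> turns \<open>a\<close> into
    \<open>b - a\<close>, \<open>b\<close> into 0, and the \<open>N - x - y\<close> zeros into
    \<open>b\<close>.\<close>
  have "b * int N - n = (b - a) * int x + b * int (N - x - y)"
    using xy by (simp add: n of_nat_diff algebra_simps)
  with n show "\<exists>x y. n = a * int x + b * int y"
    "\<exists>u v. b * int N - n = (b - a) * int u + b * int v"
    by blast+
next
  assume "(\<exists>x y. n = a * int x + b * int y) \<and>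
    (\<exists>u v. b * int N - n = (b - a) * int u + b * int v)"
  then obtain x y u v where n: "n = a * int x + b * int y"
    and m: "b * int N - n = (b - a) * int u + b * int v"
    by blast
  show "n \<in> fold_sumset N {0, a, b}"
  proof (cases "x \<le> u")
    case True
    then have "(b - a) * int x \<le> (b - a) * int u"
      using assms by (intro mult_left_mono) auto
    moreover have "0 \<le> b * int v"
      using assms by simp
    \<comment> \<open>Adding the two representations gives
      \<open>b * N = b * (x + y) + (b - a) * (u - x) + b * v\<close>.\<close>
    ultimately have "b * int (x + y) \<le> b * int N"
      using n m by (simp add: algebra_simps)
    then have "x + y \<le> N"
      using assms by simp
    with n show ?thesis
      unfolding fold_sumset_triple by blast
  next
    case False
    \<comment> \<open>An integer, since \<open>N - u - v\<close> is not yet known to be nonnegative;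
      that follows from \<open>int y \<le> w\<close> below.\<close>
    define w where "w = int N - int u - int v"
    have w: "n = a * int u + b * w"
      using m by (simp add: w_def algebra_simps)
    have "a * int u \<le> a * int x"
      using False assms by (intro mult_left_mono) auto
    then have "b * int y \<le> b * w"
      using n w by linarith
    then have "int y \<le> w"
      using assms by simp
    then have "n = a * int u + b * int (nat w)" "u + nat w \<le> N"
      using w by (auto simp: w_def)
    then show ?thesis
      unfolding fold_sumset_triple by blast
  qed
qed

theorem mainTheorem2:
  fixes a b :: int and A :: "int set" and N :: nat
  assumes "0 < a" and "a < b" and "coprime a b"
    and "A = {0, a, b}"
    and "N \<ge> 1"
  shows "fold_sumset N A =
    {0..b * int N} - (exceptional A \<union> reflect (b * int N) (exceptional (reflect b A)))"
proof -
  \<comment> \<open>Stated for a general \<open>c\<close> to serve both \<open>a\<close> and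
    \<open>b - a\<close>. The strict bounds make 0, \<open>c\<close>, \<open>b\<close> distinct, so
    the sum over the set has three separate terms.\<close>
  have span: "k \<in> nat_span {0, c, b} \<longleftrightarrow> (\<exists>x y. k = c * int x + b * int y)"
    if "0 < c" "c < b" for c k
  proof
    assume "k \<in> nat_span {0, c, b}"
    then obtain f :: "int \<Rightarrow> nat" where "k = (\<Sum>z\<in>{0, c, b}. int (f z) * z)"
      unfolding nat_span_def by blast
    with that have "k = c * int (f c) + b * int (f b)"
      by simp
    then show "\<exists>x y. k = c * int x + b * int y"
      by blast
  next
    assume "\<exists>x y. k = c * int x + b * int y"
    then obtain x y where k: "k = c * int x + b * int y"
      by blast
    \<comment> \<open>The value at 0 is arbitrary, being multiplied by 0.\<close>
    define f where "f z = (if z = c then x else y)" for z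
    have "k = (\<Sum>z\<in>{0, c, b}. int (f z) * z)"
      using that by (simp add: k f_def)
    then show "k \<in> nat_span {0, c, b}"
      unfolding nat_span_def by blast
  qed
  have nonneg: "0 \<le> k" if "k \<in> nat_span {0, c, b}" "0 < c" "c < b" for c k
    using that by (auto simp: span)
  have refl: "reflect b A = {0, b - a, b}"
    unfolding reflect_def \<open>A = {0, a, b}\<close> by auto
  have bounds: "0 < b - a" "b - a < b"
    using assms by simp_all
  have reflect_iff: "n \<in> reflect m Y \<longleftrightarrow> m - n \<in> Y" for n m Y
    unfolding reflect_def by force
  show ?thesis
  proof (rule set_eqI)
    fix n
    have "n \<in> fold_sumset N A \<longleftrightarrow>
        n \<in> nat_span A \<and> b * int N - n \<in> nat_span (reflect b A)"
      unfolding refl unfolding \<open>A = {0, a, b}\<close> span[OF \<open>0 < a\<close> \<open>a < b\<close>] span[OF bounds]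
      by (rule fold_sumset_triple_iff[OF \<open>0 < a\<close> \<open>a < b\<close>])
    \<comment> \<open>Both spans are nonnegative, which confines \<open>n\<close> to the interval.
      Conversely, inside it \<open>n\<close> and \<open>b * int N - n\<close> are natural numbers,
      so not being exceptional means lying in the span.\<close>
    moreover have "0 \<le> n" if "n \<in> nat_span A"
      using nonneg[of n a] that assms by blast
    moreover have "n \<le> b * int N" if "b * int N - n \<in> nat_span (reflect b A)"
      using nonneg[OF that[unfolded refl] bounds] by simp
    ultimately show "n \<in> fold_sumset N A \<longleftrightarrow> n \<in> {0..b * int N} -
        (exceptional A \<union> reflect (b * int N) (exceptional (reflect b A)))"
      by (auto simp: exceptional_def reflect_iff Nats_altdef1)
  qed
qed

end
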